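(* Let $\varphi:\mathfrak{h}\to V^*$ be a complex factorization structure and $i,j\in\{1,\ldots,m\}$. The factorization curves $\psi_i$ and $\psi_j$ have the same image if and only if there exists an invertible projective transformation $\Phi_{ji}:\mathbb{P}(V_i)\to\mathbb{P}(V_j)$ such that $\psi_i(\ell)=\psi_j(\Phi_{ji}(\ell))$ for all $\ell\in\mathbb{P}(V_i)$.
   Context: $V_1,\ldots,V_m$ are 2-dimensional complex vector spaces, $V^*=V_1^*\otimes\cdots\otimes V_m^*$, $\Sigma^0_{j,\ell}=V_1^*\otimes\cdots\otimes\ell^0\otimes\cdots\otimes V_m^*$ ($\ell^0$ the annihilator of $\ell$, in slot $j$). A factorization structure of dimension $m$ is an injective linear map $\varphi:\mathfrak{h}\to V^*$, $\dim\mathfrak{h}=m+1$, with $\dim(\varphi(\mathfrak{h})\cap\Sigma^0_{j,\ell})=1$ for all $j$ and all $\ell$ in a nonempty Zariski-open subset of $\mathbb{P}(V_j)$. The $j$-th factorization curve $\psi_j:\mathbb{P}(V_j)\to\mathbb{P}(\mathfrak{h})$ is the unique regular extension to $\mathbb{P}(V_j)$ of the generically defined regular map $\ell\mapsto\varphi^{-1}(\varphi(\mathfrak{h})\cap\Sigma^0_{j,\ell})$. *)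

theory Defs
  imports "HOL-Analysis.Analysis"
begin

text \<open>Model: after choosing bases, each V_k is complex^2, its dual V_k^* is complex^2 with the
pairing below, V^* = V_1^* \<otimes> ... \<otimes> V_m^* is complex^(bool^'m) (slots indexed by the finite
type 'm, so m = CARD('m); in slot k, False/True index the two basis covectors), and
h is complex^'h with CARD('h) = m + 1. All linear algebra is complex-linear (vec.*).\<close>

definition pairing :: "complex^2 \<Rightarrow> complex^2 \<Rightarrow> complex" where
  "pairing a v = a$1 * v$1 + a$2 * v$2"

definition annihilator :: "(complex^2) set \<Rightarrow> (complex^2) set" where
  "annihilator L = {a. \<forall>v\<in>L. pairing a v = 0}"

text \<open>Elementary tensor alpha_1 \<otimes> ... \<otimes> alpha_m.\<close>
definition elem_tensor :: "('m::finite \<Rightarrow> complex^2) \<Rightarrow> complex^(bool^'m)" where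
  "elem_tensor \<alpha> = (\<chi> s. \<Prod>k\<in>UNIV. \<alpha> k $ (if s$k then 2 else 1))"

text \<open>Sigma^0_{j,l} = V_1^* \<otimes> ... \<otimes> l^0 \<otimes> ... \<otimes> V_m^* (l^0 in slot j).\<close>
definition Sigma0 :: "'m::finite \<Rightarrow> (complex^2) set \<Rightarrow> (complex^(bool^'m)) set" where
  "Sigma0 j L = vec.span {elem_tensor \<alpha> | \<alpha>. \<alpha> j \<in> annihilator L}"

text \<open>Projective space P(W): the set of one-dimensional subspaces of W.\<close>
definition proj_points :: "((complex^'n) set) set" where
  "proj_points = {L. vec.subspace L \<and> vec.dim L = 1}"

text \<open>Zariski-open subsets of P^1 = P(complex^2): the empty set and the complements of finite sets.\<close>
definition zariski_open_P1 :: "(complex^2) set set \<Rightarrow> bool" where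
  "zariski_open_P1 U \<longleftrightarrow> U \<subseteq> proj_points \<and> (U = {} \<or> finite (proj_points - U))"

definition factorization_structure :: "(complex^'h \<Rightarrow> complex^(bool^'m::finite)) \<Rightarrow> bool" where
  "factorization_structure \<phi> \<longleftrightarrow>
     CARD('h) = CARD('m) + 1 \<and> Vector_Spaces.linear (*s) (*s) \<phi> \<and> inj \<phi> \<and>
     (\<forall>j::'m. \<exists>U. zariski_open_P1 U \<and> U \<noteq> {} \<and>
        (\<forall>L\<in>U. vec.dim (range \<phi> \<inter> Sigma0 j L) = 1))"

text \<open>Homogeneous polynomial map of degree d: v \<mapsto> (sum_{a\<le>d} p k a * v1^a * v2^(d-a))_k.\<close>
definition hom_poly_map :: "nat \<Rightarrow> ('h \<Rightarrow> nat \<Rightarrow> complex) \<Rightarrow> complex^2 \<Rightarrow> complex^'h::finite" where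
  "hom_poly_map d p v = (\<chi> k. \<Sum>a\<le>d. p k a * v$1 ^ a * v$2 ^ (d - a))"

text \<open>Regular maps P^1 \<rightarrow> P(h): given by homogeneous polynomials of a common degree
without common zero.\<close>
definition regular_map_P1 :: "((complex^2) set \<Rightarrow> (complex^'h::finite) set) \<Rightarrow> bool" where
  "regular_map_P1 \<psi> \<longleftrightarrow> (\<exists>d p. \<forall>v::complex^2. v \<noteq> 0 \<longrightarrow>
       hom_poly_map d p v \<noteq> 0 \<and> \<psi> (vec.span {v}) = vec.span {hom_poly_map d p v})"

text \<open>psi is the j-th factorization curve: a regular map P(V_j) \<rightarrow> P(h) extending the
generically defined map l \<mapsto> phi^{-1}(phi(h) \<inter> Sigma^0_{j,l}) (which is then unique).\<close>
definition factorization_curve ::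
  "(complex^'h \<Rightarrow> complex^(bool^'m::finite)) \<Rightarrow> 'm \<Rightarrow> ((complex^2) set \<Rightarrow> (complex^'h::finite) set) \<Rightarrow> bool" where
  "factorization_curve \<phi> j \<psi> \<longleftrightarrow> regular_map_P1 \<psi> \<and>
     (\<exists>U. zariski_open_P1 U \<and> U \<noteq> {} \<and>
        (\<forall>L\<in>U. vec.dim (range \<phi> \<inter> Sigma0 j L) = 1 \<and> \<psi> L = \<phi> -` (range \<phi> \<inter> Sigma0 j L)))"

end

theory Submission
  imports Defs
    "HOL-Computational_Algebra.Polynomial_Factorial"
    "HOL-Computational_Algebra.Fundamental_Theorem_Algebra"
    "HOL-Computational_Algebra.Field_as_Ring"
begin

text \<open>
  A factorization curve \<open>\<psi>\<^sub>k\<close>, given by a homogeneous polynomial map \<open>P\<close>, satisfies the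
  incidence relation \<open>\<phi>(P v) \<in> \<Sigma>\<^sup>0\<^sub>k\<^sub>,\<^sub>[\<^sub>v\<^sub>]\<close> for generic and hence, by polynomial identity,
  for all \<open>v\<close>. As the point \<open>\<phi>(P v)\<close> determines its line \<open>[v]\<close>, \<open>\<psi>\<^sub>k\<close> is injective, and a point
  of \<open>\<psi>\<^sub>i\<close> lying on \<open>\<psi>\<^sub>j\<close> determines its parameter on \<open>\<psi>\<^sub>j\<close> as the kernel of a contraction,
  which is polynomial in the parameter. If the images agree, this gives a reparametrization
  \<open>t \<mapsto> [F t : G t]\<close> with coprime polynomials \<open>F, G\<close> that is injective off a finite set;
  a Wronskian argument shows \<open>deg F, deg G \<le> 1\<close>, so it is a projectivity, and the identity
  \<open>\<psi>\<^sub>i = \<psi>\<^sub>j \<circ> \<Phi>\<close> extends from the affine chart to all of \<open>\<P>\<^sup>1\<close> because both sides are regular.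
\<close>

section \<open>Binary forms\<close>

inductive binary_form :: "nat \<Rightarrow> (complex^2 \<Rightarrow> complex) \<Rightarrow> bool" where
  form_const: "binary_form 0 (\<lambda>v. c)"
| form_add: "binary_form n f \<Longrightarrow> binary_form n g \<Longrightarrow> binary_form n (\<lambda>v. f v + g v)"
| form_mult_fst: "binary_form n f \<Longrightarrow> binary_form (Suc n) (\<lambda>v. v$1 * f v)"
| form_mult_snd: "binary_form n f \<Longrightarrow> binary_form (Suc n) (\<lambda>v. v$2 * f v)"

lemma form_zero: "binary_form n (\<lambda>v. 0)"
proof (induction n)
  case 0
  show ?case using form_const[of 0] by simp
next
  case (Suc n)
  show ?case using form_mult_fst[OF Suc] by simp
qed

lemma form_scale: "binary_form n f \<Longrightarrow> binary_form n (\<lambda>v. c * f v)"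
proof (induction rule: binary_form.induct)
  case (form_const d)
  show ?case using binary_form.form_const by simp
next
  case (form_add n f g)
  show ?case using binary_form.form_add[OF form_add.IH] by (simp add: algebra_simps)
next
  case (form_mult_fst n f)
  show ?case using binary_form.form_mult_fst[OF form_mult_fst.IH] by (simp add: algebra_simps)
next
  case (form_mult_snd n f)
  show ?case using binary_form.form_mult_snd[OF form_mult_snd.IH] by (simp add: algebra_simps)
qed

lemma form_scale_right: "binary_form n f \<Longrightarrow> binary_form n (\<lambda>v. f v * c)"
  using form_scale[of n f c] by (simp add: mult.commute)

lemma form_mult: "binary_form n f \<Longrightarrow> binary_form m g \<Longrightarrow> binary_form (n + m) (\<lambda>v. f v * g v)"
proof (induction rule: binary_form.induct)
  case (form_const d)
  show ?case using form_scale[OF form_const] by simp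
next
  case (form_add n f1 f2)
  show ?case using binary_form.form_add[OF form_add.IH] form_add.prems by (simp add: algebra_simps)
next
  case (form_mult_fst n f)
  show ?case using binary_form.form_mult_fst[OF form_mult_fst.IH] form_mult_fst.prems
    by (simp add: algebra_simps)
next
  case (form_mult_snd n f)
  show ?case using binary_form.form_mult_snd[OF form_mult_snd.IH] form_mult_snd.prems
    by (simp add: algebra_simps)
qed

lemma form_diff: "binary_form n f \<Longrightarrow> binary_form n g \<Longrightarrow> binary_form n (\<lambda>v. f v - g v)"
  using form_add[of n f "\<lambda>v. (-1) * g v"] form_scale[of n g "-1"] by simp

lemma form_sum:
  "finite A \<Longrightarrow> (\<And>a. a \<in> A \<Longrightarrow> binary_form n (f a)) \<Longrightarrow> binary_form n (\<lambda>v. \<Sum>a\<in>A. f a v)"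
proof (induction A rule: finite_induct)
  case empty
  show ?case using form_zero by simp
next
  case (insert x F)
  then show ?case using form_add[of n "f x" "\<lambda>v. \<Sum>a\<in>F. f a v"] by simp
qed

lemma form_coord: "binary_form 1 (\<lambda>v. v $ k)"
proof -
  have "binary_form 1 (\<lambda>v. v $ 1)" "binary_form 1 (\<lambda>v. v $ 2)"
    using form_mult_fst[OF form_const[of 1]] form_mult_snd[OF form_const[of 1]] by simp_all
  then show ?thesis using exhaust_2[of k] by auto
qed

lemma form_power: "binary_form 1 g \<Longrightarrow> binary_form k (\<lambda>v. g v ^ k)"
proof (induction k)
  case 0
  show ?case using form_const[of 1] by simp
next
  case (Suc k)
  then show ?case using form_mult[of 1 g k "\<lambda>v. g v ^ k"] by simp
qed

lemma form_hom_poly_map: "binary_form d (\<lambda>v. hom_poly_map d p v $ k)"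
proof -
  have "binary_form d (\<lambda>v. p k a * (v$1 ^ a * v$2 ^ (d - a)))" if "a \<le> d" for a
  proof -
    have "binary_form (a + (d - a)) (\<lambda>v. v$1 ^ a * v$2 ^ (d - a))"
      by (rule form_mult[OF form_power form_power]) (rule form_coord)+
    with that show ?thesis using form_scale by simp
  qed
  then show ?thesis
    unfolding hom_poly_map_def using form_sum[of "{..d}" d] by (simp add: mult.assoc)
qed

lemma form_linear_image:
  fixes \<phi> :: "complex^'h::finite \<Rightarrow> complex^'n"
  assumes "Vector_Spaces.linear (*s) (*s) \<phi>" and "\<And>k. binary_form d (\<lambda>v. f v $ k)"
  shows "binary_form d (\<lambda>v. \<phi> (f v) $ r)"
proof -
  have "binary_form d (\<lambda>v. \<Sum>i\<in>UNIV. f v $ i * \<phi> (axis i 1) $ r)"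
    by (intro form_sum form_scale_right assms(2)) simp
  moreover have "(\<lambda>v. \<phi> (f v) $ r) = (\<lambda>v. \<Sum>i\<in>UNIV. f v $ i * \<phi> (axis i 1) $ r)"
    by (rule ext) (rule linear_componentwise[OF assms(1)])
  ultimately show ?thesis by simp
qed

lemma form_compose_linear:
  assumes "binary_form n f" and lin: "Vector_Spaces.linear (*s) (*s) A"
  shows "binary_form n (\<lambda>v. f (A v))"
  using assms(1)
proof (induction rule: binary_form.induct)
  case (form_const c)
  show ?case by (rule binary_form.form_const)
next
  case (form_add n f g)
  show ?case using form_add.IH by (rule binary_form.form_add)
next
  case (form_mult_fst n f)
  show ?case
    using form_mult[OF form_linear_image[OF lin form_coord, of 1] form_mult_fst.IH] by simp
next
  case (form_mult_snd n f)
  show ?case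
    using form_mult[OF form_linear_image[OF lin form_coord, of 2] form_mult_snd.IH] by simp
qed

lemma binary_form_expansion:
  "binary_form n f \<Longrightarrow> \<exists>c. \<forall>v. f v = (\<Sum>a\<le>n. c a * v$1^a * v$2^(n - a))"
proof (induction rule: binary_form.induct)
  case (form_const c)
  show ?case by (intro exI[of _ "\<lambda>_. c"]) simp
next
  case (form_add n f g)
  then obtain c1 c2 where "\<forall>v. f v = (\<Sum>a\<le>n. c1 a * v$1^a * v$2^(n - a))"
      "\<forall>v. g v = (\<Sum>a\<le>n. c2 a * v$1^a * v$2^(n - a))" by blast
  then show ?case
    by (intro exI[of _ "\<lambda>a. c1 a + c2 a"]) (simp add: sum.distrib algebra_simps)
next
  case (form_mult_fst n f)
  then obtain c where c: "\<forall>v. f v = (\<Sum>a\<le>n. c a * v$1^a * v$2^(n - a))" by blast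
  show ?case
  proof (intro exI[of _ "\<lambda>a. if a = 0 then 0 else c (a - 1)"] allI)
    fix v :: "complex^2"
    show "v$1 * f v = (\<Sum>a\<le>Suc n. (if a = 0 then 0 else c (a - 1)) * v$1^a * v$2^(Suc n - a))"
      unfolding sum.atMost_Suc_shift using c by (simp add: sum_distrib_left algebra_simps)
  qed
next
  case (form_mult_snd n f)
  then obtain c where c: "\<forall>v. f v = (\<Sum>a\<le>n. c a * v$1^a * v$2^(n - a))" by blast
  show ?case
  proof (intro exI[of _ "\<lambda>a. if a \<le> n then c a else 0"] allI)
    fix v :: "complex^2"
    have "(\<Sum>a\<le>Suc n. (if a \<le> n then c a else 0) * v$1^a * v$2^(Suc n - a))
        = (\<Sum>a\<le>n. c a * v$1^a * v$2^(Suc n - a))" by simp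
    also have "\<dots> = (\<Sum>a\<le>n. v$2 * (c a * v$1^a * v$2^(n - a)))"
      by (intro sum.cong refl) (simp add: Suc_diff_le algebra_simps)
    finally show "v$2 * f v = (\<Sum>a\<le>Suc n. (if a \<le> n then c a else 0) * v$1^a * v$2^(Suc n - a))"
      using c by (simp add: sum_distrib_left)
  qed
qed

lemma hom_poly_map_if_forms:
  assumes "\<And>k. binary_form d (\<lambda>v. f v $ k)"
  obtains p where "f = hom_poly_map d p"
proof -
  have "\<forall>k. \<exists>c. \<forall>v. f v $ k = (\<Sum>a\<le>d. c a * v$1^a * v$2^(d - a))"
    using binary_form_expansion[OF assms] by blast
  from choice[OF this] obtain p where "\<forall>k v. f v $ k = (\<Sum>a\<le>d. p k a * v$1^a * v$2^(d - a))"
    by blast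
  then have "f = hom_poly_map d p" by (auto simp: hom_poly_map_def vec_eq_iff)
  then show ?thesis by (rule that)
qed

lemma form_dehomogenize:
  assumes "binary_form n f"
  obtains q where "\<And>t. f (vector [t, 1]) = poly q t"
proof -
  obtain c where c: "\<forall>v. f v = (\<Sum>a\<le>n. c a * v$1^a * v$2^(n - a))"
    using binary_form_expansion[OF assms] by blast
  show ?thesis
    by (rule that[of "\<Sum>a\<le>n. monom (c a) a"]) (simp add: c poly_sum poly_monom)
qed

lemma form_eq_0_if_infinite_roots:
  assumes "binary_form n f" and "infinite {t. f (vector [t, 1]) = 0}"
  shows "f v = 0"
proof -
  obtain c where c: "\<forall>v. f v = (\<Sum>a\<le>n. c a * v$1^a * v$2^(n - a))"
    using binary_form_expansion[OF assms(1)] by blast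
  have chart: "f (vector [t, 1]) = (\<Sum>a\<le>n. c a * t^a)" for t
    using c by simp
  have "c a = 0" if "a \<le> n" for a
  proof (rule ccontr)
    assume "c a \<noteq> 0"
    then have "finite {t. (\<Sum>i\<le>n. c i * t ^ i) = 0}"
      using that by (intro polyfun_rootbound_finite) blast
    with assms(2) show False unfolding chart by simp
  qed
  then show ?thesis using c by simp
qed

section \<open>The projective line\<close>

lemma proj_points_iff: "L \<in> (proj_points :: (complex^'n) set set) \<longleftrightarrow> (\<exists>v. v \<noteq> 0 \<and> L = vec.span {v})"
proof
  assume "L \<in> proj_points"
  then have sub: "vec.subspace L" and dim: "vec.dim L = 1" by (auto simp: proj_points_def)
  obtain B where B: "B \<subseteq> L" "vec.independent B" "L \<subseteq> vec.span B" "card B = vec.dim L"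
    using vec.basis_exists by blast
  then obtain v where "B = {v}" using dim by (auto simp: card_Suc_eq)
  moreover have "vec.span B \<subseteq> L" using B sub by (simp add: vec.span_minimal)
  ultimately show "\<exists>v. v \<noteq> 0 \<and> L = vec.span {v}" using B by auto
next
  assume "\<exists>v. v \<noteq> 0 \<and> L = vec.span {v}"
  then show "L \<in> proj_points" by (auto simp: proj_points_def)
qed

lemma span_singleton_eq_iff_minors:
  fixes X Y :: "complex^'n"
  assumes "X \<noteq> 0" "Y \<noteq> 0"
  shows "vec.span {X} = vec.span {Y} \<longleftrightarrow> (\<forall>k l. X$k * Y$l = X$l * Y$k)"
proof
  assume "vec.span {X} = vec.span {Y}"
  then have "Y \<in> vec.span {X}" using vec.span_base[of Y "{Y}"] by simp
  then obtain c where "Y = c *s X" by (auto simp: vec.span_singleton)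
  then show "\<forall>k l. X$k * Y$l = X$l * Y$k" by simp
next
  assume minors: "\<forall>k l. X$k * Y$l = X$l * Y$k"
  obtain k where k: "X$k \<noteq> 0" using assms(1) by (auto simp: vec_eq_iff)
  define c where "c = Y$k / X$k"
  have Y: "Y = c *s X"
    unfolding vec_eq_iff c_def using minors k by (auto simp: field_simps)
  then have "c \<noteq> 0" using assms(2) by auto
  then show "vec.span {X} = vec.span {Y}"
    using vec.span_image_scale[of "{X}" "\<lambda>_. c"] Y by simp
qed

lemma span_singleton_eq_iff_det:
  fixes v w :: "complex^2"
  assumes "v \<noteq> 0" "w \<noteq> 0"
  shows "vec.span {v} = vec.span {w} \<longleftrightarrow> v$1 * w$2 = v$2 * w$1"
  unfolding span_singleton_eq_iff_minors[OF assms] by (auto simp: forall_2)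

lemma vector_2_eq_0_iff: "vector [a, b] = (0::'a::zero^2) \<longleftrightarrow> a = 0 \<and> b = 0"
  by (auto simp: vec_eq_iff forall_2)

abbreviation chart :: "complex \<Rightarrow> complex^2" where
  "chart t \<equiv> vector [t, 1]"

lemma chart_neq_0: "chart t \<noteq> 0"
  by (simp add: vector_2_eq_0_iff)

lemma span_chart_in_proj_points: "vec.span {chart t} \<in> proj_points"
  using proj_points_iff chart_neq_0 by blast

lemma span_chart_eq_iff: "vec.span {chart s} = vec.span {chart t} \<longleftrightarrow> s = t"
  using span_singleton_eq_iff_det[OF chart_neq_0 chart_neq_0] by simp

lemma infinite_chart_preimage:
  assumes "finite (proj_points - U)"
  shows "infinite {t. vec.span {chart t} \<in> U}"
proof -
  let ?L = "\<lambda>t. vec.span {chart t}"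
  have "?L ` {t. ?L t \<notin> U} \<subseteq> proj_points - U"
    using span_chart_in_proj_points by blast
  then have "finite (?L ` {t. ?L t \<notin> U})" using assms by (rule finite_subset)
  moreover have "inj_on ?L {t. ?L t \<notin> U}"
    by (auto intro: inj_onI simp: span_chart_eq_iff)
  ultimately have "finite {t. ?L t \<notin> U}" by (rule finite_imageD)
  then have "infinite (UNIV - {t. ?L t \<notin> U})"
    using infinite_UNIV_char_0 by (rule Diff_infinite_finite)
  moreover have "UNIV - {t. ?L t \<notin> U} = {t. ?L t \<in> U}" by blast
  ultimately show ?thesis by simp
qed

lemma linear_inj_neq_0:
  assumes "Vector_Spaces.linear (*s) (*s) A" "inj A" "v \<noteq> 0"
  shows "A v \<noteq> (0 :: complex^'n)"
  using assms vec.linear_0[OF assms(1)] by (metis injD)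

lemma image_span_singleton_linear:
  "Vector_Spaces.linear (*s) (*s) A \<Longrightarrow> A ` vec.span {v} = vec.span {A v}"
  using vec.linear_span_image[of A "{v}"] by simp

lemma proj_points_image_linear_bij:
  fixes A :: "complex^'n \<Rightarrow> complex^'n"
  assumes lin: "Vector_Spaces.linear (*s) (*s) A" and "bij A"
  shows "(`) A ` proj_points = proj_points"
proof
  show "(`) A ` proj_points \<subseteq> proj_points"
  proof
    fix L assume "L \<in> (`) A ` proj_points"
    then obtain v where "v \<noteq> 0" "L = A ` vec.span {v}" by (auto simp: proj_points_iff)
    then have "A v \<noteq> 0" "L = vec.span {A v}"
      using linear_inj_neq_0[OF lin bij_is_inj[OF \<open>bij A\<close>]] image_span_singleton_linear[OF lin]
      by simp_all
    then show "L \<in> proj_points" unfolding proj_points_iff by blast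
  qed
next
  show "proj_points \<subseteq> (`) A ` proj_points"
  proof
    fix L :: "(complex^'n) set"
    assume "L \<in> proj_points"
    then obtain w where w: "w \<noteq> 0" "L = vec.span {w}" by (auto simp: proj_points_iff)
    obtain v where v: "w = A v" using surjD[OF bij_is_surj[OF \<open>bij A\<close>], of w] by blast
    then have "v \<noteq> 0" using w(1) vec.linear_0[OF lin] by auto
    then have "vec.span {v} \<in> proj_points" by (auto simp: proj_points_iff)
    moreover have "L = A ` vec.span {v}"
      using w(2) v image_span_singleton_linear[OF lin] by simp
    ultimately show "L \<in> (`) A ` proj_points" by blast
  qed
qed

section \<open>Regular maps from the projective line\<close>

lemma regular_map_P1_compose_linear:
  assumes "regular_map_P1 \<psi>" and lin: "Vector_Spaces.linear (*s) (*s) A" and "inj A"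
  shows "regular_map_P1 (\<lambda>L. \<psi> (A ` L))"
proof -
  obtain d p where P: "\<And>v. v \<noteq> 0 \<Longrightarrow>
      hom_poly_map d p v \<noteq> 0 \<and> \<psi> (vec.span {v}) = vec.span {hom_poly_map d p v}"
    using assms(1) by (auto simp: regular_map_P1_def)
  obtain p' where "(\<lambda>v. hom_poly_map d p (A v)) = hom_poly_map d p'"
    using hom_poly_map_if_forms[of d "\<lambda>v. hom_poly_map d p (A v)"]
      form_compose_linear[OF form_hom_poly_map lin] by blast
  then have p': "hom_poly_map d p' v = hom_poly_map d p (A v)" for v
    by (simp add: fun_eq_iff)
  show ?thesis
    unfolding regular_map_P1_def
  proof (intro exI allI impI)
    fix v :: "complex^2"
    assume "v \<noteq> 0"
    then have "A v \<noteq> 0" by (rule linear_inj_neq_0[OF lin \<open>inj A\<close>])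
    then show "hom_poly_map d p' v \<noteq> 0 \<and> \<psi> (A ` vec.span {v}) = vec.span {hom_poly_map d p' v}"
      using P[of "A v"] by (simp add: p' image_span_singleton_linear[OF lin])
  qed
qed

text \<open>The \<open>2 \<times> 2\<close> minors of the two polynomial representatives form a binary form.\<close>
lemma regular_maps_P1_eq:
  assumes "regular_map_P1 \<psi>1" "regular_map_P1 \<psi>2"
    and "infinite {t. \<psi>1 (vec.span {chart t}) = \<psi>2 (vec.span {chart t})}"
    and "L \<in> proj_points"
  shows "\<psi>1 L = \<psi>2 L"
proof -
  obtain d1 p1 where P1: "\<And>v. v \<noteq> 0 \<Longrightarrow>
      hom_poly_map d1 p1 v \<noteq> 0 \<and> \<psi>1 (vec.span {v}) = vec.span {hom_poly_map d1 p1 v}"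
    using assms(1) by (auto simp: regular_map_P1_def)
  obtain d2 p2 where P2: "\<And>v. v \<noteq> 0 \<Longrightarrow>
      hom_poly_map d2 p2 v \<noteq> 0 \<and> \<psi>2 (vec.span {v}) = vec.span {hom_poly_map d2 p2 v}"
    using assms(2) by (auto simp: regular_map_P1_def)
  have eq_iff: "\<psi>1 (vec.span {v}) = \<psi>2 (vec.span {v}) \<longleftrightarrow> (\<forall>k l.
      hom_poly_map d1 p1 v $ k * hom_poly_map d2 p2 v $ l -
      hom_poly_map d1 p1 v $ l * hom_poly_map d2 p2 v $ k = 0)" if "v \<noteq> 0" for v
    using span_singleton_eq_iff_minors[of "hom_poly_map d1 p1 v" "hom_poly_map d2 p2 v"]
      P1[OF that] P2[OF that] by simp
  obtain v where v: "v \<noteq> 0" "L = vec.span {v}" using assms(4) by (auto simp: proj_points_iff)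
  have "hom_poly_map d1 p1 v $ k * hom_poly_map d2 p2 v $ l -
      hom_poly_map d1 p1 v $ l * hom_poly_map d2 p2 v $ k = 0" for k l
  proof (rule form_eq_0_if_infinite_roots)
    show "binary_form (d1 + d2) (\<lambda>v. hom_poly_map d1 p1 v $ k * hom_poly_map d2 p2 v $ l -
        hom_poly_map d1 p1 v $ l * hom_poly_map d2 p2 v $ k)"
      by (intro form_diff form_mult form_hom_poly_map)
    show "infinite {t. hom_poly_map d1 p1 (chart t) $ k * hom_poly_map d2 p2 (chart t) $ l -
        hom_poly_map d1 p1 (chart t) $ l * hom_poly_map d2 p2 (chart t) $ k = 0}"
      using eq_iff[OF chart_neq_0] by (intro infinite_super[OF _ assms(3)]) blast
  qed
  then show ?thesis using eq_iff[OF v(1)] v(2) by blast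
qed

section \<open>Injective pencils of binary forms\<close>

lemma coprime_no_common_root:
  fixes F G :: "complex poly"
  assumes "coprime F G" "poly F r = 0" "poly G r = 0"
  shows False
proof -
  have "[:-r, 1:] dvd F" "[:-r, 1:] dvd G" using assms(2,3) by (simp_all add: poly_eq_0_iff_dvd)
  then have "is_unit [:-r, 1:]" using assms(1) coprime_common_divisor by blast
  then show False using is_unit_iff_degree[of "[:-r, 1:]"] by simp
qed

lemma coprime_pair_neq_0:
  fixes F G :: "complex poly"
  assumes "coprime F G"
  shows "vector [poly F t, poly G t] \<noteq> (0 :: complex^2)"
  using coprime_no_common_root[OF assms] by (auto simp: vector_2_eq_0_iff)

lemma wronskian_neq_0_if_coprime:
  fixes F G :: "complex poly"
  assumes cop: "coprime F G" and "max (degree F) (degree G) > 0"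
  shows "pderiv F * G - F * pderiv G \<noteq> 0"
proof
  assume "pderiv F * G - F * pderiv G = 0"
  then have eq: "pderiv F * G = F * pderiv G" by simp
  have "F \<noteq> 0"
  proof
    assume "F = 0"
    then have "is_unit G" using cop by simp
    then have "degree G = 0" by (cases "G = 0") (auto simp: is_unit_iff_degree)
    with assms(2) \<open>F = 0\<close> show False by simp
  qed
  have "F dvd pderiv F * G" using eq by simp
  then have "F dvd pderiv F" using coprime_dvd_mult_left_iff[OF cop] by simp
  have "degree F = 0"
  proof (rule ccontr)
    assume "degree F \<noteq> 0"
    then have "pderiv F \<noteq> 0" by (simp add: pderiv_eq_0_iff)
    with \<open>F dvd pderiv F\<close> have "degree F \<le> degree (pderiv F)" by (rule dvd_imp_degree_le)
    with \<open>degree F \<noteq> 0\<close> show False by (simp add: degree_pderiv)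
  qed
  then have "pderiv F = 0" by (simp add: pderiv_eq_0_iff)
  with eq \<open>F \<noteq> 0\<close> have "pderiv G = 0" by simp
  with \<open>degree F = 0\<close> assms(2) show False by (simp add: pderiv_eq_0_iff)
qed

lemma poly_two_distinct_roots:
  fixes h :: "complex poly"
  assumes "degree h \<ge> 2" and simple: "\<And>r. poly h r = 0 \<Longrightarrow> poly (pderiv h) r \<noteq> 0"
  obtains r1 r2 where "r1 \<noteq> r2" "poly h r1 = 0" "poly h r2 = 0"
proof -
  have "\<not> constant (poly h)" using assms(1) by (simp add: constant_degree)
  then obtain r1 where r1: "poly h r1 = 0" using fundamental_theorem_of_algebra by blast
  then obtain q where q: "h = [:-r1, 1:] * q" using poly_eq_0_iff_dvd by blast
  have "h \<noteq> 0" using assms(1) by auto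
  then have "degree h = 1 + degree q" unfolding q by (subst degree_mult_eq) auto
  with assms(1) have "\<not> constant (poly q)" by (simp add: constant_degree)
  then obtain r2 where r2: "poly q r2 = 0" using fundamental_theorem_of_algebra by blast
  have "r1 \<noteq> r2"
  proof
    assume "r1 = r2"
    then obtain q2 where q2: "q = [:-r1, 1:] * q2" using r2 poly_eq_0_iff_dvd by blast
    have double_root: "poly (pderiv (p * (p * q2))) r1 = 0" if "poly p r1 = 0" for p
      using that by (simp add: pderiv_mult)
    have "poly (pderiv h) r1 = 0"
      unfolding q q2 by (rule double_root) simp
    with simple r1 show False by blast
  qed
  moreover have "poly h r2 = 0" using q r2 by simp
  ultimately show ?thesis using that r1 by blast
qed

text \<open>
  If \<open>n = max (deg F) (deg G) \<ge> 2\<close>, choose \<open>c\<close> avoiding the finitely many values of \<open>F/G\<close> at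
  roots of the Wronskian and at \<open>S\<close>, and the ratio of leading coefficients; then \<open>F - c G\<close>
  has degree \<open>n\<close> and only simple roots, so two of them are distinct points with \<open>F/G = c\<close>.
\<close>
lemma degree_le_1_if_injective_pencil:
  fixes F G :: "complex poly"
  assumes cop: "coprime F G" and fin: "finite S"
    and inj: "\<And>t1 t2. t1 \<notin> S \<Longrightarrow> t2 \<notin> S \<Longrightarrow> poly F t1 * poly G t2 = poly F t2 * poly G t1 \<Longrightarrow> t1 = t2"
  shows "degree F \<le> 1 \<and> degree G \<le> 1"
proof (rule ccontr)
  define n where "n = max (degree F) (degree G)"
  assume "\<not> (degree F \<le> 1 \<and> degree G \<le> 1)"
  then have n2: "n \<ge> 2" by (auto simp: n_def)
  define W where "W = pderiv F * G - F * pderiv G"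
  have "W \<noteq> 0" unfolding W_def using wronskian_neq_0_if_coprime[OF cop] n2 n_def by simp
  define B where "B = (\<lambda>r. poly F r / poly G r) ` ({r. poly W r = 0} \<union> S) \<union> {coeff F n / coeff G n}"
  have "finite B" unfolding B_def using poly_roots_finite[OF \<open>W \<noteq> 0\<close>] fin by simp
  then obtain c where c: "c \<notin> B" using ex_new_if_finite[OF infinite_UNIV_char_0] by blast
  define h where "h = F - smult c G"
  have "coeff h n \<noteq> 0"
  proof (cases "coeff G n = 0")
    case True
    then have "degree G \<noteq> n \<or> G = 0" by (cases "degree G = n") auto
    then have "degree F = n" using n2 unfolding n_def by (auto simp: max_def split: if_splits)
    moreover from this n2 have "F \<noteq> 0" by auto
    ultimately have "coeff F n \<noteq> 0" by (metis leading_coeff_0_iff)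
    then show ?thesis using True by (simp add: h_def)
  next
    case False
    have "c \<noteq> coeff F n / coeff G n" using c by (auto simp: B_def)
    then show ?thesis using False by (simp add: h_def field_simps)
  qed
  then have "degree h \<ge> 2" using n2 le_degree order_trans by blast
  have root: "poly G r \<noteq> 0 \<and> c = poly F r / poly G r" if "poly h r = 0" for r
  proof -
    have e: "poly F r = c * poly G r" using that by (simp add: h_def)
    then have "poly G r \<noteq> 0" using coprime_no_common_root[OF cop, of r] by auto
    then show ?thesis using e by simp
  qed
  have notS: "r \<notin> S" if "poly h r = 0" for r
    using root[OF that] c by (auto simp: B_def)
  have "poly (pderiv h) r \<noteq> 0" if "poly h r = 0" for r
  proof
    assume "poly (pderiv h) r = 0"
    then have "poly (pderiv F) r = c * poly (pderiv G) r"
      by (simp add: h_def pderiv_diff pderiv_smult)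
    moreover have "poly F r = c * poly G r" using that by (simp add: h_def)
    ultimately have "poly W r = 0" by (simp add: W_def algebra_simps)
    then have "c \<in> B" using root[OF that] by (auto simp: B_def)
    with c show False by simp
  qed
  with \<open>degree h \<ge> 2\<close> obtain r1 r2 where r: "r1 \<noteq> r2" "poly h r1 = 0" "poly h r2 = 0"
    by (rule poly_two_distinct_roots)
  have "poly F r1 * poly G r2 = poly F r2 * poly G r1"
    using root[OF r(2)] root[OF r(3)] by (simp add: field_simps)
  then show False using inj notS[OF r(2)] notS[OF r(3)] r(1) by blast
qed

lemma poly_degree_le_1:
  fixes F :: "complex poly"
  assumes "degree F \<le> 1"
  shows "poly F t = coeff F 0 + t * coeff F 1"
proof -
  have "F = [:coeff F 0, coeff F 1:]"
  proof (rule poly_eqI)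
    fix n show "coeff F n = coeff [:coeff F 0, coeff F 1:] n"
      using assms by (cases n) (auto simp: coeff_eq_0 coeff_pCons split: nat.split)
  qed
  then have "poly F t = poly [:coeff F 0, coeff F 1:] t" by (rule arg_cong)
  then show ?thesis by simp
qed

lemma linear_bij_if_injective_pencil:
  fixes F G :: "complex poly"
  assumes cop: "coprime F G" and fin: "finite S"
    and inj: "\<And>t1 t2. t1 \<notin> S \<Longrightarrow> t2 \<notin> S \<Longrightarrow> poly F t1 * poly G t2 = poly F t2 * poly G t1 \<Longrightarrow> t1 = t2"
  obtains A :: "complex^2 \<Rightarrow> complex^2"
  where "Vector_Spaces.linear (*s) (*s) A" "bij A" "\<And>t. A (chart t) = vector [poly F t, poly G t]"
proof -
  have deg: "degree F \<le> 1" "degree G \<le> 1"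
    using degree_le_1_if_injective_pencil[OF assms] by blast+
  define a b c d where "a = coeff F 1" "b = coeff F 0" "c = coeff G 1" "d = coeff G 0"
  have F: "poly F t = a * t + b" and G: "poly G t = c * t + d" for t
    using poly_degree_le_1[OF deg(1)] poly_degree_le_1[OF deg(2)] by (simp_all add: a_b_c_d_def mult.commute)
  define D where "D = a * d - b * c"
  have "D \<noteq> 0"
  proof
    assume "D = 0"
    obtain t1 where t1: "t1 \<notin> S" using ex_new_if_finite[OF infinite_UNIV_char_0 fin] by blast
    obtain t2 where t2: "t2 \<notin> insert t1 S"
      using ex_new_if_finite[OF infinite_UNIV_char_0, of "insert t1 S"] fin by blast
    have "poly F t1 * poly G t2 - poly F t2 * poly G t1 = (t1 - t2) * D"
      unfolding F G D_def by (simp add: algebra_simps)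
    with \<open>D = 0\<close> have "poly F t1 * poly G t2 = poly F t2 * poly G t1" by simp
    then have "t1 = t2" using inj[OF t1] t2 by blast
    with t2 show False by simp
  qed
  define M :: "complex^2^2" where "M = vector [vector [a, b], vector [c, d]]"
  have M: "M *v v = vector [a * v$1 + b * v$2, c * v$1 + d * v$2]" for v
    by (simp add: M_def matrix_vector_mult_def vec_eq_iff forall_2 sum_2)
  have "bij ((*v) M)"
    unfolding invertible_eq_bij[symmetric] invertible_det_nz det_2
    using \<open>D \<noteq> 0\<close> by (simp add: M_def D_def)
  moreover have "M *v chart t = vector [poly F t, poly G t]" for t
    by (simp add: M F G mult.commute)
  ultimately show ?thesis using that matrix_vector_mul_linear_gen by blast
qed

section \<open>Contraction in a tensor slot\<close>

definition slot_upd :: "bool^'m \<Rightarrow> 'm \<Rightarrow> bool \<Rightarrow> bool^'m" where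
  "slot_upd s k b = (\<chi> l. if l = k then b else s$l)"

text \<open>
  The coefficients of the contraction of \<open>T\<close> with \<open>v\<close> in slot \<open>k\<close> (independent of \<open>s$k\<close>);
  \<open>Sigma0 k (vec.span {v})\<close> is their common kernel.
\<close>
definition contract_slot :: "'m::finite \<Rightarrow> complex^2 \<Rightarrow> complex^(bool^'m) \<Rightarrow> bool^'m \<Rightarrow> complex" where
  "contract_slot k v T s = v$1 * T $ slot_upd s k False + v$2 * T $ slot_upd s k True"

lemma slot_upd_same: "slot_upd s k (s$k) = s"
  by (simp add: slot_upd_def vec_eq_iff)

lemma elem_tensor_slot_upd:
  "elem_tensor \<alpha> $ slot_upd s k b
     = \<alpha> k $ (if b then 2 else 1) * (\<Prod>l\<in>UNIV - {k}. \<alpha> l $ (if s$l then 2 else 1))"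
proof -
  have "elem_tensor \<alpha> $ slot_upd s k b = (\<Prod>l\<in>UNIV. \<alpha> l $ (if slot_upd s k b $ l then 2 else 1))"
    by (simp add: elem_tensor_def)
  also have "\<dots> = \<alpha> k $ (if b then 2 else 1) *
      (\<Prod>l\<in>UNIV - {k}. \<alpha> l $ (if slot_upd s k b $ l then 2 else 1))"
    by (subst prod.remove[of UNIV k]) (auto simp: slot_upd_def)
  also have "(\<Prod>l\<in>UNIV - {k}. \<alpha> l $ (if slot_upd s k b $ l then 2 else 1))
      = (\<Prod>l\<in>UNIV - {k}. \<alpha> l $ (if s$l then 2 else 1))"
    by (intro prod.cong refl) (auto simp: slot_upd_def)
  finally show ?thesis .
qed

lemma contract_slot_Sigma0:
  assumes "T \<in> Sigma0 k (vec.span {v})"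
  shows "contract_slot k v T s = 0"
  using assms unfolding Sigma0_def
proof (induction rule: vec.span_induct_alt)
  case base
  show ?case by (simp add: contract_slot_def)
next
  case (step c x y)
  then obtain \<alpha> where x: "x = elem_tensor \<alpha>" and "\<alpha> k \<in> annihilator (vec.span {v})" by blast
  then have "pairing (\<alpha> k) v = 0" using vec.span_base[of v "{v}"] by (auto simp: annihilator_def)
  moreover have "contract_slot k v x s
      = pairing (\<alpha> k) v * (\<Prod>l\<in>UNIV - {k}. \<alpha> l $ (if s$l then 2 else 1))"
    by (simp add: contract_slot_def x elem_tensor_slot_upd pairing_def algebra_simps)
  ultimately have "contract_slot k v x s = 0" by simp
  moreover have "contract_slot k v (c *s x + y) s = c * contract_slot k v x s + contract_slot k v y s"
    by (simp add: contract_slot_def algebra_simps)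
  ultimately show ?case using step.IH by simp
qed

lemma contract_slot_scale: "contract_slot k v (c *s T) s = c * contract_slot k v T s"
  by (simp add: contract_slot_def algebra_simps)

lemma tensor_eq_0_if_slot_entries_0:
  assumes "\<And>s. T $ slot_upd s k False = 0 \<and> T $ slot_upd s k True = 0"
  shows "T = 0"
proof -
  have "T $ s = 0" for s
    using assms[of s] slot_upd_same[of s k] by (cases "s$k") auto
  then show ?thesis by (simp add: vec_eq_iff)
qed

lemma tensor_eq_0_if_contract_slot_0:
  assumes "\<And>s. contract_slot k v T s = 0" "\<And>s. contract_slot k w T s = 0"
    and det: "v$1 * w$2 - v$2 * w$1 \<noteq> 0"
  shows "T = 0"
proof (rule tensor_eq_0_if_slot_entries_0)
  fix s
  define P Q where "P = T $ slot_upd s k False" "Q = T $ slot_upd s k True"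
  have "v$1 * P + v$2 * Q = 0" "w$1 * P + w$2 * Q = 0"
    using assms(1,2)[of s] by (simp_all add: contract_slot_def P_Q_def)
  moreover have "(v$1 * w$2 - v$2 * w$1) * P = w$2 * (v$1 * P + v$2 * Q) - v$2 * (w$1 * P + w$2 * Q)"
    and "(v$1 * w$2 - v$2 * w$1) * Q = v$1 * (w$1 * P + w$2 * Q) - w$1 * (v$1 * P + v$2 * Q)"
    by (simp_all add: algebra_simps)
  ultimately show "P = 0 \<and> Q = 0" using det by simp
qed

section \<open>Factorization curves\<close>

lemma factorization_curve_incidence:
  fixes \<phi> :: "complex^'h::finite \<Rightarrow> complex^(bool^'m::finite)"
  assumes lin: "Vector_Spaces.linear (*s) (*s) \<phi>" and fc: "factorization_curve \<phi> k \<psi>"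
  obtains d p where
    "\<And>v. v \<noteq> 0 \<Longrightarrow> hom_poly_map d p v \<noteq> 0 \<and> \<psi> (vec.span {v}) = vec.span {hom_poly_map d p v}"
    "\<And>v s. contract_slot k v (\<phi> (hom_poly_map d p v)) s = 0"
proof -
  obtain d p where P: "\<And>v. v \<noteq> 0 \<Longrightarrow>
      hom_poly_map d p v \<noteq> 0 \<and> \<psi> (vec.span {v}) = vec.span {hom_poly_map d p v}"
    using fc by (auto simp: factorization_curve_def regular_map_P1_def)
  obtain U where U: "zariski_open_P1 U" "U \<noteq> {}" "\<And>L. L \<in> U \<Longrightarrow> \<psi> L = \<phi> -` (range \<phi> \<inter> Sigma0 k L)"
    using fc unfolding factorization_curve_def by blast
  have "contract_slot k v (\<phi> (hom_poly_map d p v)) s = 0" for v s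
  proof (rule form_eq_0_if_infinite_roots)
    show "binary_form (Suc d) (\<lambda>v. contract_slot k v (\<phi> (hom_poly_map d p v)) s)"
      unfolding contract_slot_def
      by (intro form_add form_mult_fst form_mult_snd form_linear_image[OF lin] form_hom_poly_map)
    have "\<phi> (hom_poly_map d p (chart t)) \<in> Sigma0 k (vec.span {chart t})"
      if "vec.span {chart t} \<in> U" for t
    proof -
      have "hom_poly_map d p (chart t) \<in> \<psi> (vec.span {chart t})"
        using P[OF chart_neq_0] vec.span_base[of _ "{hom_poly_map d p (chart t)}"] by simp
      then show ?thesis using U(3)[OF that] by simp
    qed
    then have "{t. vec.span {chart t} \<in> U} \<subseteq> {t. contract_slot k (chart t) (\<phi> (hom_poly_map d p (chart t))) s = 0}"
      using contract_slot_Sigma0 by blast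
    moreover have "finite (proj_points - U)" using U(1,2) by (auto simp: zariski_open_P1_def)
    ultimately show "infinite {t. contract_slot k (chart t) (\<phi> (hom_poly_map d p (chart t))) s = 0}"
      using infinite_chart_preimage infinite_super by blast
  qed
  with P show ?thesis using that by blast
qed

lemma factorization_curve_inj_on:
  assumes fs: "factorization_structure \<phi>" and fc: "factorization_curve \<phi> k \<psi>"
  shows "inj_on \<psi> proj_points"
proof (rule inj_onI)
  fix L1 L2 assume "L1 \<in> proj_points" "L2 \<in> proj_points" and eq: "\<psi> L1 = \<psi> L2"
  then obtain v w where v: "v \<noteq> 0" "L1 = vec.span {v}" and w: "w \<noteq> 0" "L2 = vec.span {w}"
    by (auto simp: proj_points_iff)
  have lin: "Vector_Spaces.linear (*s) (*s) \<phi>" and "inj \<phi>"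
    using fs by (auto simp: factorization_structure_def)
  obtain d p where P: "\<And>v. v \<noteq> 0 \<Longrightarrow>
      hom_poly_map d p v \<noteq> 0 \<and> \<psi> (vec.span {v}) = vec.span {hom_poly_map d p v}"
    and incid: "\<And>v s. contract_slot k v (\<phi> (hom_poly_map d p v)) s = 0"
    using factorization_curve_incidence[OF lin fc] by blast
  show "L1 = L2"
  proof (rule ccontr)
    assume "L1 \<noteq> L2"
    then have det: "v$1 * w$2 - v$2 * w$1 \<noteq> 0"
      using span_singleton_eq_iff_det[OF v(1) w(1)] v(2) w(2) by simp
    have "hom_poly_map d p v \<in> vec.span {hom_poly_map d p w}"
      using eq v w P vec.span_base[of "hom_poly_map d p v" "{hom_poly_map d p v}"] by auto
    then obtain c where "hom_poly_map d p v = c *s hom_poly_map d p w"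
      by (auto simp: vec.span_singleton)
    then have "contract_slot k w (\<phi> (hom_poly_map d p v)) s = 0" for s
      using incid[of w s] by (simp add: vec.linear_scale[OF lin] contract_slot_scale)
    then have "\<phi> (hom_poly_map d p v) = 0"
      using tensor_eq_0_if_contract_slot_0[OF incid _ det] by blast
    then have "hom_poly_map d p v = 0"
      using \<open>inj \<phi>\<close> vec.linear_0[OF lin] by (metis injD)
    with P[OF v(1)] show False by blast
  qed
qed

text \<open>
  A point \<open>x t\<close> of a regular curve lying on \<open>\<psi>\<^sub>j([w])\<close> satisfies
  \<open>w$1 * qa t + w$2 * qb t = 0\<close> for the polynomial coefficients \<open>qa, qb\<close> of \<open>\<phi>(x t)\<close> at a
  suitable pair of entries, so \<open>[w] = [qb t : -qa t]\<close>; dividing out \<open>gcd qb (-qa)\<close> leaves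
  a coprime pair.
\<close>
lemma factorization_curve_reparametrization:
  fixes \<phi> :: "complex^'h::finite \<Rightarrow> complex^(bool^'m::finite)"
  assumes fs: "factorization_structure \<phi>" and fc: "factorization_curve \<phi> j \<psi>j"
    and "regular_map_P1 \<psi>" and img: "\<psi> ` proj_points \<subseteq> \<psi>j ` proj_points"
  obtains F G :: "complex poly" and S where "coprime F G" "finite S"
    "\<And>t. t \<notin> S \<Longrightarrow> \<psi> (vec.span {chart t}) = \<psi>j (vec.span {vector [poly F t, poly G t]})"
proof -
  have lin: "Vector_Spaces.linear (*s) (*s) \<phi>" and "inj \<phi>"
    using fs by (auto simp: factorization_structure_def)
  obtain d1 p1 where P1: "\<And>v. v \<noteq> 0 \<Longrightarrow>
      hom_poly_map d1 p1 v \<noteq> 0 \<and> \<psi> (vec.span {v}) = vec.span {hom_poly_map d1 p1 v}"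
    using assms(3) by (auto simp: regular_map_P1_def)
  obtain d2 p2 where P2: "\<And>v. v \<noteq> 0 \<Longrightarrow>
      hom_poly_map d2 p2 v \<noteq> 0 \<and> \<psi>j (vec.span {v}) = vec.span {hom_poly_map d2 p2 v}"
    and incid: "\<And>v s. contract_slot j v (\<phi> (hom_poly_map d2 p2 v)) s = 0"
    using factorization_curve_incidence[OF lin fc] by blast
  define x where "x t = hom_poly_map d1 p1 (chart t)" for t
  have "\<phi> (x 0) \<noteq> 0"
    using P1[OF chart_neq_0] \<open>inj \<phi>\<close> vec.linear_0[OF lin] unfolding x_def by (metis injD)
  then obtain s where s: "\<phi> (x 0) $ slot_upd s j False \<noteq> 0 \<or> \<phi> (x 0) $ slot_upd s j True \<noteq> 0"
    using tensor_eq_0_if_slot_entries_0 by blast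
  obtain qa where qa: "\<And>t. \<phi> (x t) $ slot_upd s j False = poly qa t"
    using form_dehomogenize[OF form_linear_image[OF lin form_hom_poly_map]] unfolding x_def by blast
  obtain qb where qb: "\<And>t. \<phi> (x t) $ slot_upd s j True = poly qb t"
    using form_dehomogenize[OF form_linear_image[OF lin form_hom_poly_map]] unfolding x_def by blast
  define g where "g = gcd qb (- qa)"
  have "g \<noteq> 0" using s qa[of 0] qb[of 0] by (auto simp: g_def)
  obtain F G where F: "qb = F * g" and G: "- qa = G * g" and "coprime F G"
    using gcd_coprime_exists[OF \<open>g \<noteq> 0\<close>[unfolded g_def]] unfolding g_def[symmetric] by blast
  have qa_eq: "qa = - (G * g)" using G by (metis minus_minus)
  have "\<psi> (vec.span {chart t}) = \<psi>j (vec.span {vector [poly F t, poly G t]})" if "poly g t \<noteq> 0" for t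
  proof -
    have "\<psi> (vec.span {chart t}) \<in> \<psi>j ` proj_points"
      using img span_chart_in_proj_points by blast
    then obtain w where w: "w \<noteq> 0" "\<psi> (vec.span {chart t}) = \<psi>j (vec.span {w})"
      by (auto simp: proj_points_iff)
    have "x t \<in> vec.span {hom_poly_map d2 p2 w}"
      using P1[OF chart_neq_0] P2[OF w(1)] w(2) vec.span_base[of "x t" "{x t}"] by (simp add: x_def)
    then obtain c where "x t = c *s hom_poly_map d2 p2 w" by (auto simp: vec.span_singleton)
    then have "contract_slot j w (\<phi> (x t)) s = 0"
      using incid[of w s] by (simp add: vec.linear_scale[OF lin] contract_slot_scale)
    moreover have "contract_slot j w (\<phi> (x t)) s = - (poly g t * (w$1 * poly G t - w$2 * poly F t))"
      unfolding contract_slot_def qa qb qa_eq F by (simp add: algebra_simps)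
    ultimately have "w$1 * poly G t = w$2 * poly F t" using that by simp
    then have "vec.span {w} = vec.span {vector [poly F t, poly G t]}"
      using span_singleton_eq_iff_det[OF w(1) coprime_pair_neq_0[OF \<open>coprime F G\<close>]] by simp
    with w(2) show ?thesis by simp
  qed
  then show ?thesis
    using that[OF \<open>coprime F G\<close> poly_roots_finite[OF \<open>g \<noteq> 0\<close>]] by blast
qed

lemma projectivity_if_image_eq:
  assumes fs: "factorization_structure \<phi>"
    and fci: "factorization_curve \<phi> i \<psi>i" and fcj: "factorization_curve \<phi> j \<psi>j"
    and img: "\<psi>i ` proj_points = \<psi>j ` proj_points"
  obtains A :: "complex^2 \<Rightarrow> complex^2"
  where "Vector_Spaces.linear (*s) (*s) A" "bij A" "\<And>L. L \<in> proj_points \<Longrightarrow> \<psi>i L = \<psi>j (A ` L)"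
proof -
  have reg: "regular_map_P1 \<psi>i" "regular_map_P1 \<psi>j"
    using fci fcj by (simp_all add: factorization_curve_def)
  obtain F G S where "coprime F G" "finite S"
    and R: "\<And>t. t \<notin> S \<Longrightarrow> \<psi>i (vec.span {chart t}) = \<psi>j (vec.span {vector [poly F t, poly G t]})"
    using factorization_curve_reparametrization[OF fs fcj reg(1) equalityD1[OF img]] by blast
  have "t1 = t2" if "t1 \<notin> S" "t2 \<notin> S" "poly F t1 * poly G t2 = poly F t2 * poly G t1" for t1 t2
  proof -
    have "vec.span {vector [poly F t1, poly G t1] :: complex^2} = vec.span {vector [poly F t2, poly G t2]}"
      using that(3) by (subst span_singleton_eq_iff_det; simp add: coprime_pair_neq_0[OF \<open>coprime F G\<close>] mult.commute)
    then have "\<psi>i (vec.span {chart t1}) = \<psi>i (vec.span {chart t2})"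
      using that(1,2) R by simp
    then have "vec.span {chart t1} = vec.span {chart t2}"
      by (rule inj_onD[OF factorization_curve_inj_on[OF fs fci]]) (rule span_chart_in_proj_points)+
    then show ?thesis by (simp add: span_chart_eq_iff)
  qed
  then obtain A :: "complex^2 \<Rightarrow> complex^2"
    where lin: "Vector_Spaces.linear (*s) (*s) A" and "bij A"
    and A: "\<And>t. A (chart t) = vector [poly F t, poly G t]"
    using linear_bij_if_injective_pencil[OF \<open>coprime F G\<close> \<open>finite S\<close>] by blast
  have "UNIV - S \<subseteq> {t. \<psi>i (vec.span {chart t}) = \<psi>j (A ` vec.span {chart t})}"
  proof
    fix t assume "t \<in> UNIV - S"
    then show "t \<in> {t. \<psi>i (vec.span {chart t}) = \<psi>j (A ` vec.span {chart t})}"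
      using R[of t] by (simp add: A image_span_singleton_linear[OF lin])
  qed
  moreover have "infinite (UNIV - S)"
    by (rule Diff_infinite_finite[OF \<open>finite S\<close> infinite_UNIV_char_0])
  ultimately have "infinite {t. \<psi>i (vec.span {chart t}) = \<psi>j (A ` vec.span {chart t})}"
    by (rule infinite_super)
  then have "\<psi>i L = \<psi>j (A ` L)" if "L \<in> proj_points" for L
    by (rule regular_maps_P1_eq[OF reg(1)
          regular_map_P1_compose_linear[OF reg(2) lin bij_is_inj[OF \<open>bij A\<close>]] _ that])
  with lin \<open>bij A\<close> show ?thesis by (rule that)
qed

theorem lemma2p12:
  fixes \<phi> :: "complex^'h::finite \<Rightarrow> complex^(bool^'m::finite)"
    and i j :: 'm
    and \<psi>i \<psi>j :: "(complex^2) set \<Rightarrow> (complex^'h) set"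
  assumes "factorization_structure \<phi>"
    and "factorization_curve \<phi> i \<psi>i"
    and "factorization_curve \<phi> j \<psi>j"
  shows "\<psi>i ` proj_points = \<psi>j ` proj_points \<longleftrightarrow>
         (\<exists>A :: complex^2 \<Rightarrow> complex^2. Vector_Spaces.linear (*s) (*s) A \<and> bij A \<and>
            (\<forall>L\<in>proj_points. \<psi>i L = \<psi>j (A ` L)))"
proof
  assume "\<psi>i ` proj_points = \<psi>j ` proj_points"
  then obtain A :: "complex^2 \<Rightarrow> complex^2"
    where "Vector_Spaces.linear (*s) (*s) A" "bij A" "\<And>L. L \<in> proj_points \<Longrightarrow> \<psi>i L = \<psi>j (A ` L)"
    using projectivity_if_image_eq[OF assms] by blast
  then show "\<exists>A :: complex^2 \<Rightarrow> complex^2. Vector_Spaces.linear (*s) (*s) A \<and> bij A \<and>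
      (\<forall>L\<in>proj_points. \<psi>i L = \<psi>j (A ` L))" by blast
next
  assume "\<exists>A :: complex^2 \<Rightarrow> complex^2. Vector_Spaces.linear (*s) (*s) A \<and> bij A \<and>
      (\<forall>L\<in>proj_points. \<psi>i L = \<psi>j (A ` L))"
  then obtain A :: "complex^2 \<Rightarrow> complex^2"
    where "Vector_Spaces.linear (*s) (*s) A" "bij A" "\<forall>L\<in>proj_points. \<psi>i L = \<psi>j (A ` L)"
    by blast
  then have "\<psi>i ` proj_points = \<psi>j ` ((`) A ` proj_points)"
    by (simp add: image_image)
  also have "\<dots> = \<psi>j ` proj_points"
    using proj_points_image_linear_bij[OF \<open>Vector_Spaces.linear (*s) (*s) A\<close> \<open>bij A\<close>] by simp
  finally show "\<psi>i ` proj_points = \<psi>j ` proj_points" .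
qed

end
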